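(* Let $\alpha\in(0,1)$, $k_\alpha=\alpha/(1-\alpha)$, and let ${}^{CF}D_x^{\alpha}$ be the convolution operator ${}^{CF}D_x^{\alpha}f(x)=\frac{B(\alpha)}{1-\alpha}\int_0^x \frac{d}{dz}f(z)\,e^{-\frac{\alpha}{1-\alpha}(x-z)}\,dz$ with $B(\alpha)=1-\alpha$. Then the solution to the equation $$\frac{\partial}{\partial t}f(x,t)=-\,{}^{CF}D_x^{\alpha}f(x,t)+k_\alpha(1-t)e^{-t-k_\alpha x},\qquad x\ge 0,\ t\ge 0,$$ with initial condition $f(x,0)=0$, is given by $$f_{\mathcal S_\psi}(x,t)=k_\alpha t\,\exp\{-k_\alpha x-t\}\,W_{1,2}(k_\alpha x t),\qquad x\ge 0,$$ and this function is the density of the absolutely continuous component of the compound Poisson process $\mathcal S_\psi(t)=\sum_{j=1}^{N(t)}X_j^\psi$, where the $X_j^\psi$, $j=1,2,\dots$, are exponentially distributed with parameter $k_\alpha$.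
   Context: The operator ${}^{CF}D_x^\alpha$ acts, for $x>0$, on functions $f:\mathbb R^+\to\mathbb R$ that are differentiable, absolutely integrable and in $AC_{loc}(0,+\infty)$ (i.e. with integrable first derivative); applied to $f(x,t)$ it acts on the variable $x$. Wright function: $W_{a,b}(x):=\sum_{j=0}^\infty \frac{x^j}{j!\,\Gamma(aj+b)}$. Compound Poisson process: $\mathcal S_\psi(t)=\sum_{j=1}^{N(t)}X_j^\psi$, $t\ge 0$, where $N(t)$ is a Poisson process with parameter $\lambda=1$ and the $X_j^\psi$ are non-negative i.i.d. random variables independent of $N$. Its distribution function is $P\{\mathcal S_\psi(t)<y\}=e^{-t}1_{[0,+\infty)}(y)+\int_{-\infty}^y f_{\mathcal S_\psi}(x,t)\,dx$, and $f_{\mathcal S_\psi}(\cdot,t)$ (supported on the non-negative half-line) is called the density of the absolutely continuous component of $\mathcal S_\psi$; when the $X_j^\psi$ have density $f_{X^\psi}$, it equals $e^{-t}\sum_{n\ge1}\frac{t^n}{n!}f_{X^\psi}^{*(n)}(x)$, with $f^{*(n)}$ the $n$-fold convolution. *)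

theory Defs
  imports "HOL-Probability.Probability"
begin

text \<open>Epsilon-delta absolute continuity on \<open>[a, b]\<close>. The finite families of non-overlapping
  compact subintervals are the library's divisions; \<open>Inf k\<close> and \<open>Sup k\<close> are the endpoints of
  the interval \<open>k\<close>.\<close>

definition abs_cont_on :: "real \<Rightarrow> real \<Rightarrow> (real \<Rightarrow> real) \<Rightarrow> bool" where
  "abs_cont_on a b f \<longleftrightarrow>
     (\<forall>\<epsilon>>0. \<exists>\<delta>>0. \<forall>d. d division_of \<Union>d \<and> \<Union>d \<subseteq> {a..b} \<and> (\<Sum>k\<in>d. Sup k - Inf k) < \<delta>
        \<longrightarrow> (\<Sum>k\<in>d. \<bar>f (Sup k) - f (Inf k)\<bar>) < \<epsilon>)"

definition AC_loc_pos :: "(real \<Rightarrow> real) \<Rightarrow> bool" where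
  "AC_loc_pos f \<longleftrightarrow> (\<forall>a>0. \<forall>b. abs_cont_on a b f)"

text \<open>A function on \<open>[0, \<infinity>)\<close> is represented by a total function whose values on the negative
  half-line are irrelevant. Differentiability at \<open>0\<close> is therefore one-sided, whereas
  \<^term>\<open>deriv f 0\<close> may be meaningless; it enters only under integrals, where a single point
  does not matter.\<close>

definition CF_domain :: "(real \<Rightarrow> real) set" where
  "CF_domain = {f. f differentiable_on {0..} \<and> f absolutely_integrable_on {0..} \<and>
     AC_loc_pos f \<and> deriv f absolutely_integrable_on {0..}}"

definition CF_deriv :: "(real \<Rightarrow> real) \<Rightarrow> real \<Rightarrow> (real \<Rightarrow> real) \<Rightarrow> real \<Rightarrow> real" where
  "CF_deriv B \<alpha> f x =
     B \<alpha> / (1 - \<alpha>) * integral {0..x} (\<lambda>z. deriv f z * exp (- (\<alpha> / (1 - \<alpha>)) * (x - z)))"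

definition k_CF :: "real \<Rightarrow> real" where
  "k_CF \<alpha> = \<alpha> / (1 - \<alpha>)"

text \<open>At \<open>t = 0\<close> the time derivative is one-sided, and at \<open>x = 0\<close> the operator is the integral
  over \<open>{0}\<close>, that is \<open>0\<close>.\<close>

definition CF_solution :: "real \<Rightarrow> (real \<Rightarrow> real \<Rightarrow> real) \<Rightarrow> bool" where
  "CF_solution \<alpha> f \<longleftrightarrow>
     (\<forall>t\<ge>0. (\<lambda>x. f x t) \<in> CF_domain) \<and>
     (\<forall>x\<ge>0. \<forall>t\<ge>0.
        ((\<lambda>s. f x s) has_real_derivative
           (- CF_deriv (\<lambda>a. 1 - a) \<alpha> (\<lambda>z. f z t) x
            + k_CF \<alpha> * (1 - t) * exp (- t - k_CF \<alpha> * x))) (at t within {0..})) \<and>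
     (\<forall>x\<ge>0. f x 0 = 0)"

text \<open>At the poles of \<^term>\<open>Gamma :: real \<Rightarrow> real\<close> the summand is \<open>0\<close>, since \<^term>\<open>Gamma\<close> is
  \<open>0\<close> there and division by \<open>0\<close> yields \<open>0\<close>; this is the usual convention for the reciprocal
  Gamma function.\<close>

definition Wright :: "real \<Rightarrow> real \<Rightarrow> real \<Rightarrow> real" where
  "Wright a b x = (\<Sum>j. x ^ j / (fact j * Gamma (a * real j + b)))"

definition f_S :: "real \<Rightarrow> real \<Rightarrow> real \<Rightarrow> real" where
  "f_S \<alpha> x t = k_CF \<alpha> * t * exp (- k_CF \<alpha> * x - t) * Wright 1 2 (k_CF \<alpha> * x * t)"

text \<open>The truncated subtraction of counts is harmless: the paths are almost surely nondecreasing.\<close>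

definition poisson_process :: "'a measure \<Rightarrow> real \<Rightarrow> (real \<Rightarrow> 'a \<Rightarrow> nat) \<Rightarrow> bool" where
  "poisson_process M \<rho> N \<longleftrightarrow>
     prob_space M \<and>
     (\<forall>t\<ge>0. N t \<in> measurable M (count_space UNIV)) \<and>
     (AE \<omega> in M. N 0 \<omega> = 0 \<and> (\<forall>s\<ge>0. \<forall>t\<ge>s. N s \<omega> \<le> N t \<omega>) \<and>
        (\<forall>t\<ge>0. continuous (at_right t) (\<lambda>s. real (N s \<omega>)))) \<and>
     (\<forall>(\<tau> :: nat \<Rightarrow> real) n. 0 \<le> \<tau> 0 \<and> (\<forall>i<n. \<tau> i \<le> \<tau> (Suc i)) \<longrightarrow>
        prob_space.indep_vars M (\<lambda>_. count_space UNIV)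
          (\<lambda>i \<omega>. N (\<tau> (Suc i)) \<omega> - N (\<tau> i) \<omega>) {..<n}) \<and>
     (\<forall>s t. 0 \<le> s \<and> s < t \<longrightarrow>
        distr M (count_space UNIV) (\<lambda>\<omega>. N t \<omega> - N s \<omega>) = measure_pmf (poisson_pmf (\<rho> * (t - s))))"

text \<open>Independence of the whole process \<open>N\<close> from the whole sequence \<open>X 1, X 2, \<dots>\<close>, as
  independence of the generated sigma-algebras; the library's \<open>indep_var\<close> needs both variables
  to take values in the same type.\<close>

definition indep_process_seq :: "'a measure \<Rightarrow> (real \<Rightarrow> 'a \<Rightarrow> nat) \<Rightarrow> (nat \<Rightarrow> 'a \<Rightarrow> real) \<Rightarrow> bool" where
  "indep_process_seq M N X \<longleftrightarrow>
     prob_space.indep_set M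
       (sets (vimage_algebra (space M) (\<lambda>\<omega>. \<lambda>t\<in>{0..}. N t \<omega>)
          (\<Pi>\<^sub>M t\<in>{0..}. count_space UNIV)))
       (sets (vimage_algebra (space M) (\<lambda>\<omega>. \<lambda>j\<in>{1..}. X j \<omega>)
          (\<Pi>\<^sub>M j\<in>{1..}. borel)))"

definition compound_poisson :: "(real \<Rightarrow> 'a \<Rightarrow> nat) \<Rightarrow> (nat \<Rightarrow> 'a \<Rightarrow> real) \<Rightarrow> real \<Rightarrow> 'a \<Rightarrow> real" where
  "compound_poisson N X t \<omega> = (\<Sum>j=1..N t \<omega>. X j \<omega>)"

text \<open>The distribution function is taken right-continuous, \<open>P(S t \<le> y)\<close>: with the jump part
  \<open>exp (- t) * indicator {0..} y\<close>, the left-continuous version \<open>P(S t < y)\<close> would be off at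
  the atom \<open>y = 0\<close> and would agree elsewhere.\<close>

definition ac_component_density ::
    "'a measure \<Rightarrow> (real \<Rightarrow> 'a \<Rightarrow> real) \<Rightarrow> real \<Rightarrow> (real \<Rightarrow> real) \<Rightarrow> bool" where
  "ac_component_density M S t f \<longleftrightarrow>
     S t \<in> borel_measurable M \<and>
     integrable lborel f \<and> (\<forall>x. 0 \<le> f x) \<and> (\<forall>x<0. f x = 0) \<and>
     (\<forall>y. measure M {\<omega> \<in> space M. S t \<omega> \<le> y} =
            exp (- t) * indicator {0..} y + (LBINT x:{..y}. f x))"

end

theory Submission
  imports Defs
begin

text \<open>Integrating by parts, \<open>CF_deriv f x\<close> becomes
  \<open>f x - f 0 * exp (- k * x) - k * integral {0..x} (\<lambda>z. f z * exp (- k * (x - z)))\<close> for \<open>k = k_CF \<alpha>\<close>,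
  so that the equation for \<open>f_S\<close> reduces to the identities \<open>W\<^sub>1\<^sub>,\<^sub>1' = W\<^sub>1\<^sub>,\<^sub>2\<close> and
  \<open>W\<^sub>1\<^sub>,\<^sub>2 x + x * W\<^sub>1\<^sub>,\<^sub>3 x = W\<^sub>1\<^sub>,\<^sub>1 x\<close>.

  The difference \<open>h\<close> of two solutions satisfies
  \<open>\<bar>\<partial>h/\<partial>t\<bar> \<le> c * sup \<bar>h(\<cdot>, t)\<bar>\<close> on every strip \<open>0 \<le> x \<le> R\<close>. Gronwall's argument needs this
  supremum to be locally bounded in \<open>t\<close>; solutions are only regular in each variable separately, and
  local boundedness is obtained from Baire's theorem.

  For the compound Poisson process, condition on \<open>N t = n\<close>: the sum of \<open>n\<close> independent exponential
  variables has an Erlang density, and the Poisson mixture of these densities is the Wright series.\<close>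

subsection \<open>Wright functions\<close>

text \<open>The Wright function with parameters 1 and \<open>m + 1\<close>. The index is shifted by
  one so that the Gamma values become \<open>fact (j + m)\<close>; the functions with second
  parameter 1, 2 and 3 are \<open>wright 0\<close>, \<open>wright 1\<close> and
  \<open>wright 2\<close>.\<close>

definition wright :: "nat \<Rightarrow> real \<Rightarrow> real" where
  "wright m x = (\<Sum>j. inverse (fact j * fact (j + m)) * x ^ j)"

lemma Wright_1_eq_wright: "Wright 1 (real (Suc m)) = wright m"
proof
  fix x
  have "Gamma (1 * real j + real (Suc m)) = fact (j + m)" for j
    using Gamma_fact[of "j + m", where 'a = real] by (simp add: add_ac)
  then show "Wright 1 (real (Suc m)) x = wright m x"
    by (simp add: Wright_def wright_def field_simps)
qed

lemma summable_wright: "summable (\<lambda>j. inverse (fact j * fact (j + m)) * x ^ j :: real)"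
proof (rule summable_comparison_test')
  show "summable (\<lambda>j. norm (x ^ j /\<^sub>R fact j))"
    by (rule summable_norm_exp)
  show "norm (inverse (fact j * fact (j + m)) * x ^ j) \<le> norm (x ^ j /\<^sub>R fact j)" for j
  proof -
    have "fact (j + m) \<ge> (1 :: real)" by (rule fact_ge_1)
    then have "inverse (fact (j + m)) \<le> (1 :: real)"
      by (simp add: field_simps)
    then have "inverse (fact (j + m)) * (inverse (fact j) * \<bar>x\<bar> ^ j) \<le> 1 * (inverse (fact j) * \<bar>x\<bar> ^ j)"
      by (intro mult_right_mono) auto
    then show ?thesis by (simp add: abs_mult power_abs mult_ac)
  qed
qed

lemma wright_0 [simp]: "wright m 0 = inverse (fact m)"
  using suminf_finite[of "{0}" "\<lambda>j. inverse (fact j * fact (j + m)) * 0 ^ j :: real"]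
  by (simp add: wright_def)

text \<open>The cancellation behind both the termwise derivative and the index shift in
  \<open>wright_recurrence\<close>; \<open>c\<close> stands for the second factorial.\<close>

lemma Suc_mult_inverse_fact:
  "real (Suc j) * inverse (fact (Suc j) * c) = inverse (fact j * c)"
  by (simp add: divide_simps)

lemma has_real_derivative_wright: "(wright m has_real_derivative wright (Suc m) x) (at x)"
proof -
  have "(wright m has_real_derivative (\<Sum>j. diffs (\<lambda>j. inverse (fact j * fact (j + m))) j * x ^ j)) (at x)"
    unfolding wright_def[abs_def]
    by (rule termdiffs_strong_converges_everywhere) (rule summable_wright)
  also have "diffs (\<lambda>j. inverse (fact j * fact (j + m)) :: real) = (\<lambda>j. inverse (fact j * fact (j + Suc m)))"
    unfolding diffs_def Suc_mult_inverse_fact by simp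
  finally show ?thesis unfolding wright_def[abs_def] .
qed

lemma DERIV_wright [derivative_intros]:
  assumes "(g has_real_derivative g') (at x within S)"
  shows "((\<lambda>x. wright m (g x)) has_real_derivative wright (Suc m) (g x) * g') (at x within S)"
  by (rule DERIV_chain2[OF has_real_derivative_wright assms])

lemma continuous_on_wright [continuous_intros]:
  assumes "continuous_on S g"
  shows "continuous_on S (\<lambda>x. wright m (g x))"
proof -
  have "continuous_on UNIV (wright m)"
    by (meson DERIV_isCont continuous_at_imp_continuous_on has_real_derivative_wright)
  then show ?thesis
    using assms continuous_on_compose2 by blast
qed

lemma wright_nonneg: "0 \<le> x \<Longrightarrow> 0 \<le> wright m x"
  unfolding wright_def by (intro suminf_nonneg summable_wright) auto

text \<open>Compare coefficients: multiplication by \<open>x\<close> shifts the series of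
  \<open>wright 2\<close> to the terms \<open>d j\<close>, with \<open>d 0 = 0\<close>, and
  \<open>(1 + j) / (j! (j + 1)!) = 1 / (j! j!)\<close>.\<close>

lemma wright_recurrence: "wright 1 x + x * wright 2 x = wright 0 x"
proof -
  define d where "d j = real j * inverse (fact j * fact (j + 1)) * x ^ j" for j
  have d_Suc: "d (Suc j) = inverse (fact j * fact (j + 2)) * x ^ j * x" for j
    unfolding d_def Suc_mult_inverse_fact by (simp add: mult_ac)
  have "summable (\<lambda>j. d (Suc j))"
    unfolding d_Suc by (rule summable_mult2) (rule summable_wright)
  then have d: "summable d"
    by (simp add: summable_Suc_iff)
  have "x * wright 2 x = (\<Sum>j. d (Suc j))"
    unfolding wright_def d_Suc by (subst suminf_mult2[OF summable_wright, symmetric]) simp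
  also have "\<dots> = suminf d"
    using suminf_split_head[OF d] by (simp add: d_def)
  finally have "wright 1 x + x * wright 2 x = (\<Sum>j. inverse (fact j * fact (j + 1)) * x ^ j + d j)"
    unfolding wright_def[of 1] by (simp add: suminf_add[OF summable_wright[of 1, simplified] d])
  also have "\<dots> = wright 0 x"
    unfolding wright_def d_def by (intro suminf_cong) (simp add: divide_simps, simp add: algebra_simps)
  finally show ?thesis .
qed

text \<open>The two factorials make the growth slower than any exponential:
  \<open>x ^ j / (j!)^2\<close> splits into \<open>(1 / e) ^ j / j!\<close>, which is at most
  \<open>exp (1 / e)\<close>, times a term of the series of \<open>exp (e * x)\<close>. The freedom
  in \<open>e\<close> is what gives integrability at every time \<open>t\<close>.\<close>

lemma wright_le_exp:
  assumes "0 \<le> x" "0 < e"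
  shows "wright m x \<le> exp (1 / e) * exp (e * x)"
proof -
  have *: "(1 / e) ^ j / fact j \<le> exp (1 / e)" for j
  proof -
    have "(\<Sum>j\<in>{j}. (1 / e) ^ j /\<^sub>R fact j) \<le> (\<Sum>j. (1 / e) ^ j /\<^sub>R fact j)"
      by (rule sum_le_suminf) (use assms summable_exp_generic[of "1 / e"] in \<open>auto intro!: mult_nonneg_nonneg\<close>)
    then show ?thesis by (simp add: exp_def field_simps)
  qed
  have "wright m x \<le> (\<Sum>j. exp (1 / e) * ((e * x) ^ j /\<^sub>R fact j))"
    unfolding wright_def
  proof (rule suminf_le)
    show "summable (\<lambda>j. exp (1 / e) * ((e * x) ^ j /\<^sub>R fact j))"
      by (rule summable_mult) (rule summable_exp_generic)
    fix j
    have "inverse (fact j * fact (j + m)) * x ^ j = inverse (fact (j + m)) * (x ^ j / fact j)"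
      by (simp add: field_simps)
    also have "\<dots> \<le> inverse (fact j) * (x ^ j / fact j)"
      using assms by (intro mult_right_mono le_imp_inverse_le fact_mono) auto
    also have "\<dots> = ((1 / e) ^ j / fact j) * ((e * x) ^ j /\<^sub>R fact j)"
      using assms by (simp add: field_simps power_mult_distrib)
    also have "\<dots> \<le> exp (1 / e) * ((e * x) ^ j /\<^sub>R fact j)"
      using assms by (intro mult_right_mono *) auto
    finally show "inverse (fact j * fact (j + m)) * x ^ j \<le> exp (1 / e) * ((e * x) ^ j /\<^sub>R fact j)" .
  qed (rule summable_wright)
  also have "\<dots> = exp (1 / e) * exp (e * x)"
    unfolding exp_def by (rule suminf_mult) (rule summable_exp_generic)
  finally show ?thesis .
qed

lemma f_S_eq: "f_S \<alpha> x t = k_CF \<alpha> * t * exp (- k_CF \<alpha> * x - t) * wright 1 (k_CF \<alpha> * x * t)"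
  using Wright_1_eq_wright[of 1] by (simp add: f_S_def)

subsection \<open>Functions whose time derivative is bounded by the supremum in space\<close>

text \<open>An abstract setting for uniqueness. \<open>bound\<close> speaks of arbitrary upper
  bounds \<open>m\<close>, which avoids suprema, and \<open>fin\<close> gives finiteness at each
  single time without any uniformity in \<open>t\<close>.\<close>

locale derivative_bounded_by_sup =
  fixes X :: "'b set" and c :: real and h h' :: "'b \<Rightarrow> real \<Rightarrow> real"
  assumes c: "0 < c"
    and deriv: "\<And>x t. x \<in> X \<Longrightarrow> 0 \<le> t \<Longrightarrow> ((\<lambda>s. h x s) has_real_derivative h' x t) (at t within {0..})"
    and bound: "\<And>m t x. 0 \<le> t \<Longrightarrow> (\<And>z. z \<in> X \<Longrightarrow> \<bar>h z t\<bar> \<le> m) \<Longrightarrow> x \<in> X \<Longrightarrow> \<bar>h' x t\<bar> \<le> c * m"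
    and fin: "\<And>t. 0 \<le> t \<Longrightarrow> \<exists>m. \<forall>x\<in>X. \<bar>h x t\<bar> \<le> m"
begin

lemma continuous_on_h: "x \<in> X \<Longrightarrow> continuous_on {0..} (h x)"
  by (rule DERIV_continuous_on[where D = "h' x"]) (use deriv in auto)

text \<open>The mean value inequality started at time \<open>s\<close> gives
  \<open>M0 \<le> m + M0 / 2\<close> for the supremum \<open>M0\<close>, and \<open>M0 / 2\<close>
  can be absorbed because \<open>M0\<close> is finite. The a priori bound \<open>M\<close> serves
  only this finiteness and does not enter the conclusion.\<close>

lemma bound_on_short_interval:
  assumes ab: "0 \<le> a" "c * (b - a) \<le> 1 / 2"
    and M: "\<And>x t. x \<in> X \<Longrightarrow> t \<in> {a..b} \<Longrightarrow> \<bar>h x t\<bar> \<le> M"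
    and s: "s \<in> {a..b}" and m: "\<And>x. x \<in> X \<Longrightarrow> \<bar>h x s\<bar> \<le> m"
    and xt: "x \<in> X" "t \<in> {a..b}"
  shows "\<bar>h x t\<bar> \<le> 2 * m"
proof -
  let ?V = "(\<lambda>(x, t). \<bar>h x t\<bar>) ` (X \<times> {a..b})"
  have bdd: "bdd_above ?V" using M by (auto intro!: bdd_aboveI[of _ M])
  define M0 where "M0 = Sup ?V"
  have M0: "\<bar>h x t\<bar> \<le> M0" if "x \<in> X" "t \<in> {a..b}" for x t
    unfolding M0_def using that by (intro cSup_upper bdd) (auto intro!: image_eqI[of _ _ "(x, t)"])
  have "0 \<le> M0" using M0[OF xt] by linarith
  have "\<bar>h x t\<bar> \<le> m + M0 / 2" if "x \<in> X" "t \<in> {a..b}" for x t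
  proof -
    have "norm (h x t - h x s) \<le> (c * M0) * norm (t - s)"
    proof (rule field_differentiable_bound[where S = "{a..b}"])
      show "(h x has_field_derivative h' x z) (at z within {a..b})" if "z \<in> {a..b}" for z
        using deriv[OF \<open>x \<in> X\<close>, of z] that ab by (auto intro: DERIV_subset)
      show "norm (h' x z) \<le> c * M0" if "z \<in> {a..b}" for z
        using bound[of z M0 x] M0 that ab \<open>x \<in> X\<close> by auto
    qed (use s that in auto)
    also have "\<dots> \<le> (c * M0) * (b - a)"
      using s that c \<open>0 \<le> M0\<close> by (intro mult_left_mono) auto
    also have "\<dots> = M0 * (c * (b - a))" by simp
    also have "\<dots> \<le> M0 * (1 / 2)"
      using ab \<open>0 \<le> M0\<close> by (intro mult_left_mono) auto
    finally have "\<bar>h x t - h x s\<bar> \<le> M0 / 2" by simp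
    then show ?thesis using m[OF \<open>x \<in> X\<close>] by linarith
  qed
  then have "M0 \<le> m + M0 / 2"
    unfolding M0_def using xt by (intro cSup_least) auto
  then show ?thesis using M0[OF xt] by simp
qed

text \<open>No joint regularity of \<open>h\<close> is assumed. The set \<open>F\<close> of times near which \<open>h\<close> is not uniformly
  bounded is closed; if it were nonempty, Baire's theorem would bound \<open>h\<close> on a relatively open part
  of \<open>F\<close>, and \<open>bound_on_short_interval\<close> would carry this bound across the gaps of \<open>F\<close>.\<close>

lemma locally_uniformly_bounded:
  assumes t: "0 \<le> t"
  shows "\<exists>M. \<exists>d>0. \<forall>s\<in>{0..} \<inter> ball t d. \<forall>x\<in>X. \<bar>h x s\<bar> \<le> M"
proof -
  define good where "good t \<longleftrightarrow> (\<exists>M. \<exists>d>0. \<forall>s\<in>{0..} \<inter> ball t d. \<forall>x\<in>X. \<bar>h x s\<bar> \<le> M)" for t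
  define F where "F = {t. 0 \<le> t \<and> \<not> good t}"
  have "open {t. good t}"
    unfolding open_contains_ball
  proof safe
    fix t assume "good t"
    then obtain M d where d: "d > 0" "\<And>s x. 0 \<le> s \<Longrightarrow> s \<in> ball t d \<Longrightarrow> x \<in> X \<Longrightarrow> \<bar>h x s\<bar> \<le> M"
      unfolding good_def by (metis IntI atLeast_iff)
    have "good u" if "u \<in> ball t d" for u
    proof -
      have "u \<in> ball t d" by (fact that)
      then obtain e where "e > 0" "ball u e \<subseteq> ball t d"
        using open_contains_ball[of "ball t d"] open_ball by blast
      then show ?thesis unfolding good_def using d(2) by blast
    qed
    then show "\<exists>e>0. ball t e \<subseteq> {t. good t}" using d(1) by blast
  qed
  moreover have "F = {0..} - {t. good t}" by (auto simp: F_def)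
  ultimately have F: "closed F" by (simp add: closed_Diff)
  define E where "E n = {t \<in> {0..}. \<forall>x\<in>X. \<bar>h x t\<bar> \<le> real n}" for n :: nat
  have E: "closed (E n)" for n
  proof -
    have "E n = {0..} \<inter> (\<Inter>x\<in>X. {t \<in> {0..}. \<bar>h x t\<bar> \<le> real n})"
      by (auto simp: E_def)
    also have "closed \<dots>"
      by (intro closed_Int closed_INT ballI continuous_on_closed_Collect_le continuous_intros continuous_on_h) auto
    finally show ?thesis .
  qed
  have "F = {}"
  proof (rule ccontr)
    assume "F \<noteq> {}"
    \<comment> \<open>If no relatively open piece of \<open>F\<close> lay in some
      \<open>E n\<close>, every \<open>F - E n\<close> would be relatively open and dense in
      \<open>F\<close>. By Baire their intersection would be dense too, but it is empty by
      \<open>fin\<close>.\<close>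
    obtain n p e0 where p: "p \<in> F" "e0 > 0" "F \<inter> ball p e0 \<subseteq> E n"
    proof (rule ccontr)
      assume no: "\<not> thesis"
      let ?G = "range (\<lambda>n. F - E n)"
      have "F \<subseteq> closure (\<Inter>?G)"
      proof (rule Baire[OF F])
        fix T assume "T \<in> ?G"
        then obtain n where T: "T = F - E n" by auto
        have "openin (top_of_set F) T"
          unfolding T by (metis E Diff_eq Int_commute open_Compl openin_open)
        moreover have "F \<subseteq> closure T"
        proof
          fix q assume "q \<in> F"
          show "q \<in> closure T"
            unfolding closure_approachable
          proof safe
            fix e :: real assume "e > 0"
            then have "\<not> F \<inter> ball q e \<subseteq> E n" using that no \<open>q \<in> F\<close> by blast
            then show "\<exists>y\<in>T. dist y q < e" unfolding T by (auto simp: dist_commute)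
          qed
        qed
        ultimately show "openin (top_of_set F) T \<and> F \<subseteq> closure T" by blast
      qed auto
      moreover have "\<Inter>?G = {}"
      proof -
        have False if q: "\<And>n. q \<in> F - E n" for q
        proof -
          have "0 \<le> q" using q by (auto simp: F_def)
          then obtain m where "\<forall>x\<in>X. \<bar>h x q\<bar> \<le> m" using fin by blast
          moreover obtain n where "m \<le> real n" using real_arch_simple by blast
          ultimately have "q \<in> E n" using \<open>0 \<le> q\<close> unfolding E_def by force
          then show False using q by blast
        qed
        then show ?thesis by blast
      qed
      ultimately have "F \<subseteq> closure {}" by (simp only:)
      then show False using \<open>F \<noteq> {}\<close> by simp
    qed
    \<comment> \<open>\<open>e < e0\<close> keeps the argument inside the Baire ball, and
      \<open>c * e \<le> 1 / 2\<close> admits \<open>bound_on_short_interval\<close> on any interval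
      of length at most \<open>e\<close>.\<close>
    define e where "e = min (e0 / 2) (1 / (2 * c))"
    have e: "0 < e" "e < e0" "c * e \<le> 1 / 2"
      using \<open>e0 > 0\<close> c by (auto simp: e_def min_def field_simps)
    have "\<bar>h x t\<bar> \<le> 2 * real n" if t: "0 \<le> t" "t \<in> ball p e" and x: "x \<in> X" for x t
    proof (cases "t \<in> F")
      case True
      then have "t \<in> E n" using p t e by auto
      then show ?thesis using x by (force simp: E_def)
    next
      case False
      \<comment> \<open>The endpoint on the side of \<open>p\<close> of the gap of \<open>F\<close> that contains \<open>t\<close>.\<close>
      obtain a where a: "a \<in> F" "a \<in> closed_segment p t" "open_segment a t \<inter> F = {}"
      proof -
        have "compact (F \<inter> closed_segment p t)" by (simp add: F closed_Int_compact)
        moreover have "p \<in> F \<inter> closed_segment p t" using p by simp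
        ultimately obtain a where a: "a \<in> F \<inter> closed_segment p t"
          "\<And>y. y \<in> F \<inter> closed_segment p t \<Longrightarrow> dist t a \<le> dist t y"
          using distance_attains_inf[of "F \<inter> closed_segment p t" t] compact_imp_closed by blast
        have "open_segment a t \<inter> F = {}"
        proof -
          have False if "y \<in> open_segment a t" "y \<in> F" for y
          proof -
            have "y \<in> closed_segment p t" "dist t y < dist t a"
              using that(1) a(1) by (auto simp: open_segment_eq_real_ivl closed_segment_eq_real_ivl dist_real_def split: if_splits)
            then show False using a(2)[of y] that(2) by auto
          qed
          then show ?thesis by blast
        qed
        then show ?thesis using that a(1) by blast
      qed
      have "0 \<le> a" using a by (auto simp: F_def)
      have "a \<noteq> t" using a False by auto
      have "\<bar>a - t\<bar> \<le> e" "a \<in> ball p e0"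
        using a(2) t e by (auto simp: closed_segment_eq_real_ivl dist_real_def split: if_splits)
      then have "a \<in> E n" using a p by auto
      define l r where "l = min a t" and "r = max a t"
      have lr: "l < r" "0 \<le> l" "c * (r - l) \<le> 1 / 2" "a \<in> {l..r}" "t \<in> {l..r}"
      proof -
        have "c * \<bar>a - t\<bar> \<le> c * e" using \<open>\<bar>a - t\<bar> \<le> e\<close> c by (intro mult_left_mono) auto
        then show "c * (r - l) \<le> 1 / 2" using e by (auto simp: l_def r_def min_def max_def)
      qed (use \<open>0 \<le> a\<close> \<open>0 \<le> t\<close> \<open>a \<noteq> t\<close> in \<open>auto simp: l_def r_def\<close>)
      have seg: "{l..r} = closed_segment a t"
        by (auto simp: l_def r_def closed_segment_eq_real_ivl)
      obtain mt where mt: "\<And>x. x \<in> X \<Longrightarrow> \<bar>h x t\<bar> \<le> mt" using fin[OF \<open>0 \<le> t\<close>] by blast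
      \<comment> \<open>The segment from \<open>s\<close> to \<open>t\<close> avoids
        \<open>F\<close>, so compactness bounds \<open>h\<close> there, but perhaps ever worse as
        \<open>s\<close> approaches \<open>a\<close>. Anchoring
        \<open>bound_on_short_interval\<close> at \<open>t\<close> replaces this bound by
        \<open>2 * mt\<close>, which is independent of \<open>s\<close>.\<close>
      have *: "\<bar>h x s\<bar> \<le> 2 * mt" if s: "s \<in> closed_segment a t" "s \<noteq> a" and x: "x \<in> X" for s x
      proof -
        define l' r' where "l' = min s t" and "r' = max s t"
        have seg': "{l'..r'} = closed_segment s t"
          by (auto simp: l'_def r'_def closed_segment_eq_real_ivl)
        have sub: "{l'..r'} \<subseteq> {l..r}"
          unfolding seg seg' using s(1) by (simp add: subset_closed_segment)
        have "v \<notin> F" if "v \<in> closed_segment s t" for v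
        proof (cases "v = t")
          case False
          have "v \<noteq> a"
            using that s by (auto simp: closed_segment_eq_real_ivl split: if_splits)
          moreover have "v \<in> closed_segment a t"
            using that sub unfolding seg seg' by blast
          ultimately show ?thesis using False a(3) by (auto simp: open_segment_def)
        qed (use \<open>t \<notin> F\<close> in simp)
        then have dis: "{l'..r'} \<inter> F = {}" unfolding seg' by blast
        have "c * (r' - l') \<le> 1 / 2"
        proof -
          have "l' \<le> r'" by (auto simp: l'_def r'_def)
          then have "r' - l' \<le> r - l" using sub by auto
          then have "c * (r' - l') \<le> c * (r - l)" using c by (intro mult_left_mono) auto
          then show ?thesis using lr by simp
        qed
        have "0 \<le> l'" using sub lr by (auto simp: l'_def r'_def)
        have "\<exists>M. \<forall>u\<in>{l'..r'}. \<forall>x\<in>X. \<bar>h x u\<bar> \<le> M"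
        proof -
          have "\<exists>M. \<exists>d>0. \<forall>v\<in>{0..} \<inter> ball u d. \<forall>x\<in>X. \<bar>h x v\<bar> \<le> M" if "u \<in> {l'..r'}" for u
            using that dis \<open>0 \<le> l'\<close> by (auto simp: F_def good_def disjoint_iff)
          then obtain M d where Md: "\<And>u. u \<in> {l'..r'} \<Longrightarrow> d u > 0"
            "\<And>u v x. u \<in> {l'..r'} \<Longrightarrow> 0 \<le> v \<Longrightarrow> v \<in> ball u (d u) \<Longrightarrow> x \<in> X \<Longrightarrow> \<bar>h x v\<bar> \<le> M u"
            by (metis IntI atLeast_iff)
          obtain D where D: "D \<subseteq> {l'..r'}" "finite D" "{l'..r'} \<subseteq> (\<Union>u\<in>D. ball u (d u))"
          proof (rule compactE_image[of "{l'..r'}" "{l'..r'}" "\<lambda>u. ball u (d u)"])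
            show "{l'..r'} \<subseteq> (\<Union>u\<in>{l'..r'}. ball u (d u))" using Md(1) by force
          qed (use that in auto)
          have "\<bar>h x u\<bar> \<le> (\<Sum>v\<in>D. \<bar>M v\<bar>)" if "u \<in> {l'..r'}" "x \<in> X" for u x
          proof -
            have "u \<in> (\<Union>u\<in>D. ball u (d u))" using D(3) that(1) by blast
            then obtain v where v: "v \<in> D" "u \<in> ball v (d v)" by blast
            have "\<bar>h x u\<bar> \<le> \<bar>M v\<bar>" using Md(2)[of v u x] v D(1) that \<open>0 \<le> l'\<close> by fastforce
            also have "\<dots> \<le> (\<Sum>v\<in>D. \<bar>M v\<bar>)" using v(1) D(2) by (intro member_le_sum) auto
            finally show ?thesis .
          qed
          then show ?thesis by blast
        qed
        then obtain M where M: "\<And>u x. u \<in> {l'..r'} \<Longrightarrow> x \<in> X \<Longrightarrow> \<bar>h x u\<bar> \<le> M" by blast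
        show ?thesis
          by (rule bound_on_short_interval[where a = l' and b = r' and s = t and M = M])
            (use \<open>0 \<le> l'\<close> \<open>c * (r' - l') \<le> 1 / 2\<close> M mt x in \<open>auto simp: l'_def r'_def\<close>)
      qed
      \<comment> \<open>Now \<open>h\<close> is bounded on the whole closed segment, by a constant
        depending on \<open>t\<close>. Anchoring at \<open>a\<close>, which lies in
        \<open>E n\<close>, turns it into \<open>2 * real n\<close>, the same for every gap.\<close>
      show ?thesis
      proof (rule bound_on_short_interval[where a = l and b = r and s = a
            and M = "max (real n) (2 * mt)"])
        show "\<bar>h x s\<bar> \<le> max (real n) (2 * mt)" if "x \<in> X" "s \<in> {l..r}" for x s
        proof (cases "s = a")
          case True
          then have "\<bar>h x s\<bar> \<le> real n" using that \<open>a \<in> E n\<close> by (auto simp: E_def)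
          then show ?thesis by simp
        next
          case False
          then have "\<bar>h x s\<bar> \<le> 2 * mt" using *[of s x] that seg by auto
          then show ?thesis by simp
        qed
        show "\<bar>h x a\<bar> \<le> real n" if "x \<in> X" for x
          using that \<open>a \<in> E n\<close> by (auto simp: E_def)
      qed (use lr x in auto)
    qed
    then have "good p" unfolding good_def using e(1) by (intro exI[of _ "2 * real n"] exI[of _ e]) auto
    then show False using p by (simp add: F_def)
  qed
  then show ?thesis using t by (auto simp: F_def good_def)
qed

text \<open>A connectedness argument on the half-line: the set \<open>Z\<close> of times at which
  \<open>h\<close> vanishes on all of \<open>X\<close> is closed by continuity in time, and open
  because \<open>bound_on_short_interval\<close> applies around a point of \<open>Z\<close> with
  \<open>m = 0\<close>.\<close>

lemma eq_0_if_initially_0: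
  assumes init: "\<And>x. x \<in> X \<Longrightarrow> h x 0 = 0" and "x \<in> X" "0 \<le> t"
  shows "h x t = 0"
proof -
  define Z where "Z = {u \<in> {0..}. \<forall>x\<in>X. h x u = 0}"
  have "connected {0::real..}" by (simp add: is_interval_connected)
  moreover have "openin (top_of_set {0..}) Z"
    unfolding openin_contains_ball
  proof safe
    fix u assume u: "u \<in> Z"
    then have "0 \<le> u" by (simp add: Z_def)
    then obtain M d where d: "d > 0" "\<And>s x. 0 \<le> s \<Longrightarrow> s \<in> ball u d \<Longrightarrow> x \<in> X \<Longrightarrow> \<bar>h x s\<bar> \<le> M"
      using locally_uniformly_bounded[of u] by (auto simp: Ball_def)
    \<comment> \<open>An interval of radius \<open>r\<close> has length at most
      \<open>2 * r\<close>, whence \<open>2 * c * r \<le> 1 / 2\<close>; \<open>r < d\<close> keeps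
      it where the local bound \<open>M\<close> holds.\<close>
    define r where "r = min (d / 2) (1 / (4 * c))"
    have r: "r > 0" "r < d" "2 * c * r \<le> 1 / 2"
      using d(1) c by (auto simp: r_def min_def field_simps)
    have "v \<in> Z" if v: "v \<in> ball u r" "0 \<le> v" for v
    proof -
      have "\<bar>h x v\<bar> \<le> 2 * 0" if "x \<in> X" for x
      proof (rule bound_on_short_interval[where a = "max 0 (u - r)" and b = "u + r" and s = u and M = M])
        have "c * (u + r - max 0 (u - r)) \<le> c * (2 * r)" using c by (intro mult_left_mono) auto
        then show "c * (u + r - max 0 (u - r)) \<le> 1 / 2" using r by simp
      qed (use u r d \<open>0 \<le> u\<close> v that in \<open>auto simp: Z_def dist_real_def\<close>)
      then show ?thesis using \<open>0 \<le> v\<close> by (simp add: Z_def)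
    qed
    then show "\<exists>e>0. ball u e \<inter> {0..} \<subseteq> Z" using r(1) by (auto intro!: exI[of _ r])
  qed (auto simp: Z_def)
  moreover have "closedin (top_of_set {0..}) Z"
  proof -
    have "Z = {0..} \<inter> (\<Inter>x\<in>X. {u \<in> {0..}. h x u = 0})" by (auto simp: Z_def)
    also have "closed \<dots>"
      by (intro closed_Int closed_INT ballI continuous_closed_preimage_constant continuous_on_h) auto
    finally have "closed Z" .
    then show ?thesis by (intro closed_subset) (auto simp: Z_def)
  qed
  moreover have "0 \<in> Z" using init by (simp add: Z_def)
  ultimately have "Z = {0..}" unfolding connected_clopen by blast
  then have "t \<in> Z" using \<open>0 \<le> t\<close> by simp
  then show ?thesis using \<open>x \<in> X\<close> by (simp add: Z_def)
qed

end

subsection \<open>The Caputo--Fabrizio equation\<close>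

lemma abs_cont_on_lipschitz:
  assumes "\<And>u v. u \<in> {a..b} \<Longrightarrow> v \<in> {a..b} \<Longrightarrow> \<bar>f u - f v\<bar> \<le> L * \<bar>u - v\<bar>"
  shows "abs_cont_on a b f"
  unfolding abs_cont_on_def
proof (intro allI impI)
  fix \<epsilon> :: real assume "\<epsilon> > 0"
  \<comment> \<open>Nothing makes \<open>L\<close> positive, and \<open>\<epsilon>\<close> is to be
    divided by the constant.\<close>
  define L' where "L' = \<bar>L\<bar> + 1"
  have L': "L' > 0" by (simp add: L'_def add_nonneg_pos)
  show "\<exists>\<delta>>0. \<forall>d. d division_of \<Union>d \<and> \<Union>d \<subseteq> {a..b} \<and> (\<Sum>k\<in>d. Sup k - Inf k) < \<delta>
        \<longrightarrow> (\<Sum>k\<in>d. \<bar>f (Sup k) - f (Inf k)\<bar>) < \<epsilon>"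
  proof (intro exI[of _ "\<epsilon> / L'"] conjI allI impI)
    fix d assume d: "d division_of \<Union>d \<and> \<Union>d \<subseteq> {a..b} \<and> (\<Sum>k\<in>d. Sup k - Inf k) < \<epsilon> / L'"
    have "(\<Sum>k\<in>d. \<bar>f (Sup k) - f (Inf k)\<bar>) \<le> (\<Sum>k\<in>d. L' * (Sup k - Inf k))"
    proof (rule sum_mono)
      fix k assume "k \<in> d"
      then obtain u v where k: "k = cbox u v" "k \<noteq> {}" "k \<subseteq> \<Union>d"
        using d cbox_division_memE by metis
      then have uv: "u \<le> v" "Inf k = u" "Sup k = v" by auto
      moreover have "{u..v} \<subseteq> {a..b}" using k d by (metis cbox_interval order_trans)
      then have "u \<in> {a..b}" "v \<in> {a..b}" using uv by auto
      ultimately have "\<bar>f (Sup k) - f (Inf k)\<bar> \<le> L * (Sup k - Inf k)"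
        using assms[of v u] by simp
      also have "\<dots> \<le> L' * (Sup k - Inf k)"
        using uv by (intro mult_right_mono) (auto simp: L'_def)
      finally show "\<bar>f (Sup k) - f (Inf k)\<bar> \<le> L' * (Sup k - Inf k)" .
    qed
    also have "\<dots> = L' * (\<Sum>k\<in>d. Sup k - Inf k)" by (simp add: sum_distrib_left)
    also have "\<dots> < L' * (\<epsilon> / L')" using d L' by (intro mult_strict_left_mono) auto
    finally show "(\<Sum>k\<in>d. \<bar>f (Sup k) - f (Inf k)\<bar>) < \<epsilon>" using L' by simp
  qed (use L' \<open>\<epsilon> > 0\<close> in simp)
qed

lemma abs_cont_on_C1:
  assumes "\<And>x. (f has_real_derivative f' x) (at x)" and "continuous_on UNIV f'"
  shows "abs_cont_on a b f"
proof -
  have "bounded (f' ` {a..b})"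
    using assms(2)
    by (intro compact_imp_bounded compact_continuous_image) (auto intro: continuous_on_subset)
  then obtain L where L: "\<forall>x\<in>{a..b}. \<bar>f' x\<bar> \<le> L"
    unfolding bounded_iff by auto
  show ?thesis
  proof (rule abs_cont_on_lipschitz)
    fix u v assume uv: "u \<in> {a..b}" "v \<in> {a..b}"
    have "norm (f u - f v) \<le> L * norm (u - v)"
      by (rule field_differentiable_bound[where S = "{a..b}" and f' = f'])
        (use assms(1) L uv in \<open>auto intro: has_field_derivative_at_within\<close>)
    then show "\<bar>f u - f v\<bar> \<le> L * \<bar>u - v\<bar>" by simp
  qed
qed

text \<open>The right-hand side involves only values of \<open>f\<close> on \<open>{0..x}\<close>,
  so it can be estimated by their supremum. The prefactor disappears because
  \<open>B \<alpha> = 1 - \<alpha>\<close>.\<close>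

lemma CF_deriv_eq:
  assumes "0 < \<alpha>" "\<alpha> < 1" and f: "f \<in> CF_domain" and x: "0 \<le> x"
  shows "CF_deriv (\<lambda>a. 1 - a) \<alpha> f x =
    f x - f 0 * exp (- k_CF \<alpha> * x) - k_CF \<alpha> * integral {0..x} (\<lambda>z. f z * exp (- k_CF \<alpha> * (x - z)))"
proof -
  define k where "k = k_CF \<alpha>"
  let ?e = "\<lambda>z. exp (- k * (x - z))"
  have df: "f differentiable_on {0..}" using f by (simp add: CF_domain_def)
  then have cont: "continuous_on {0..x} f"
    by (rule differentiable_imp_continuous_on[THEN continuous_on_subset]) auto
  have deriv: "(f has_real_derivative deriv f z) (at z)" if "z \<in> {0<..<x}" for z
  proof -
    have "f differentiable (at z within {0..})" using df that by (auto simp: differentiable_on_def)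
    moreover have "at z within {0..} = at z" using that by (intro at_within_interior) auto
    ultimately show ?thesis
      by (metis DERIV_deriv_iff_real_differentiable)
  qed
  \<comment> \<open>The interior form of the fundamental theorem is used: \<open>deriv f 0\<close>
    may be meaningless, and continuity suffices at the end points.\<close>
  have 1: "((\<lambda>z. deriv f z * ?e z + f z * (k * ?e z)) has_integral (f x * ?e x - f 0 * ?e 0)) {0..x}"
  proof (rule fundamental_theorem_of_calculus_interior)
    fix z assume "z \<in> {0<..<x}"
    show "((\<lambda>z. f z * ?e z) has_vector_derivative deriv f z * ?e z + f z * (k * ?e z)) (at z)"
      unfolding has_real_derivative_iff_has_vector_derivative[symmetric]
      by (auto intro!: derivative_eq_intros deriv[OF \<open>z \<in> {0<..<x}\<close>])
  qed (auto intro!: continuous_intros cont x)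
  have 2: "((\<lambda>z. f z * (k * ?e z)) has_integral integral {0..x} (\<lambda>z. f z * (k * ?e z))) {0..x}"
    by (intro integrable_integral integrable_continuous_interval continuous_intros cont)
  have "((\<lambda>z. deriv f z * ?e z) has_integral
     (f x * ?e x - f 0 * ?e 0 - integral {0..x} (\<lambda>z. f z * (k * ?e z)))) {0..x}"
    using has_integral_diff[OF 1 2] by simp
  moreover have "integral {0..x} (\<lambda>z. f z * (k * ?e z)) = k * integral {0..x} (\<lambda>z. f z * ?e z)"
    by (subst integral_mult_right[symmetric]) (simp add: mult_ac)
  ultimately have "integral {0..x} (\<lambda>z. deriv f z * ?e z) =
     f x - f 0 * exp (- k * x) - k * integral {0..x} (\<lambda>z. f z * ?e z)"
    by (simp add: integral_unique)
  then show ?thesis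
    using assms(1,2) unfolding CF_deriv_def k_CF_def[symmetric] k_def[symmetric] by simp
qed

section \<open>Decay of \<open>f_S\<close> and the equation it satisfies\<close>

lemma k_CF_pos: "0 < \<alpha> \<Longrightarrow> \<alpha> < 1 \<Longrightarrow> 0 < k_CF \<alpha>"
  by (simp add: k_CF_def)

text \<open>Take \<open>e = 1 / (2 * t)\<close> in \<open>wright_le_exp\<close>: the growth
  \<open>exp (k * x / 2)\<close> consumes half of the decay \<open>exp (- k * x)\<close>. The choice
  is impossible at \<open>t = 0\<close>, where the Wright factor is constant.\<close>

lemma exp_wright_bound:
  assumes "0 < k" "0 \<le> t" "0 \<le> x"
  shows "exp (- k * x - t) * wright m (k * x * t) \<le> exp t * exp (- (k / 2) * x)"
proof (cases "t = 0")
  case True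
  have "exp (- k * x) * inverse (fact m) \<le> exp (- (k / 2) * x) * 1"
    using assms by (intro mult_mono) (auto simp: field_simps)
  then show ?thesis using True by simp
next
  case False
  have "exp (- k * x - t) * wright m (k * x * t) \<le>
    exp (- k * x - t) * (exp (1 / (1 / (2 * t))) * exp (1 / (2 * t) * (k * x * t)))"
    using assms False by (intro mult_left_mono wright_le_exp) auto
  also have "\<dots> = exp t * exp (- (k / 2) * x)"
    using False by (simp add: exp_add[symmetric])
  finally show ?thesis .
qed

definition f_S' :: "real \<Rightarrow> real \<Rightarrow> real \<Rightarrow> real" where
  "f_S' \<alpha> x t = k_CF \<alpha> * t * exp (- k_CF \<alpha> * x - t) *
     (k_CF \<alpha> * t * wright 2 (k_CF \<alpha> * x * t) - k_CF \<alpha> * wright 1 (k_CF \<alpha> * x * t))"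

lemma has_derivative_f_S: "((\<lambda>x. f_S \<alpha> x t) has_real_derivative f_S' \<alpha> x t) (at x)"
  unfolding f_S_eq[abs_def] f_S'_def
  by (auto intro!: derivative_eq_intros simp: numeral_2_eq_2 algebra_simps)

lemma continuous_on_f_S: "continuous_on S (\<lambda>x. f_S \<alpha> x t)"
  unfolding f_S_eq by (intro continuous_intros)

lemma continuous_on_f_S': "continuous_on S (\<lambda>x. f_S' \<alpha> x t)"
  unfolding f_S'_def by (intro continuous_intros)

lemma absolutely_integrable_exp_bound:
  fixes f :: "real \<Rightarrow> real"
  assumes "0 < a" "continuous_on UNIV f" "\<And>x. 0 \<le> x \<Longrightarrow> \<bar>f x\<bar> \<le> C * exp (- a * x)"
  shows "f absolutely_integrable_on {0..}"
proof (rule measurable_bounded_by_integrable_imp_absolutely_integrable)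
  show "f \<in> borel_measurable (lebesgue_on {0..})"
    by (intro continuous_imp_measurable_on_sets_lebesgue continuous_on_subset[OF assms(2)]) auto
  show "(\<lambda>x. C * exp (- a * x)) integrable_on {0..}"
    using assms(1) by (intro integrable_on_mult_right integrable_on_exp_minus_to_infinity)
qed (use assms(3) in auto)

lemma f_S_nonneg: "0 < \<alpha> \<Longrightarrow> \<alpha> < 1 \<Longrightarrow> 0 \<le> t \<Longrightarrow> 0 \<le> x \<Longrightarrow> 0 \<le> f_S \<alpha> x t"
  unfolding f_S_eq using k_CF_pos[of \<alpha>] by (intro mult_nonneg_nonneg wright_nonneg) auto

text \<open>\<open>f_S\<close> and its \<open>x\<close>-derivative are combinations of
  \<open>exp (- k * x - t) * wright m (k * x * t)\<close>, which decays exponentially in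
  \<open>x\<close> by \<open>exp_wright_bound\<close>; continuity of the derivative gives local
  absolute continuity.\<close>

lemma f_S_in_CF_domain:
  assumes "0 < \<alpha>" "\<alpha> < 1" "0 \<le> t"
  shows "(\<lambda>x. f_S \<alpha> x t) \<in> CF_domain"
proof -
  define k where "k = k_CF \<alpha>"
  have k: "0 < k" using assms by (simp add: k_def k_CF_pos)
  have deriv: "deriv (\<lambda>x. f_S \<alpha> x t) = (\<lambda>x. f_S' \<alpha> x t)"
    using has_derivative_f_S by (blast intro: DERIV_imp_deriv)
  have *: "exp (- k * x - t) * wright m (k * x * t) \<le> exp t * exp (- (k / 2) * x)" if "0 \<le> x" for m x
    using exp_wright_bound[of k t x m] k assms that by simp
  have nn: "0 \<le> exp (- k * x - t) * wright m (k * x * t)" if "0 \<le> x" for m x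
    using k assms that by (intro mult_nonneg_nonneg wright_nonneg) auto
  have "\<bar>f_S \<alpha> x t\<bar> \<le> k * t * exp t * exp (- (k / 2) * x)" if x: "0 \<le> x" for x
  proof -
    have "(k * t) * (exp (- k * x - t) * wright 1 (k * x * t)) \<le> (k * t) * (exp t * exp (- (k / 2) * x))"
      using k assms by (intro mult_left_mono *) (use x in auto)
    then show ?thesis
      using f_S_nonneg[OF assms x] by (simp add: f_S_eq k_def mult_ac)
  qed
  then have 1: "(\<lambda>x. f_S \<alpha> x t) absolutely_integrable_on {0..}"
    using k by (intro absolutely_integrable_exp_bound[where a = "k / 2"] continuous_on_f_S) auto
  have "\<bar>f_S' \<alpha> x t\<bar> \<le> k * t * (k * t + k) * exp t * exp (- (k / 2) * x)" if x: "0 \<le> x" for x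
  proof -
    let ?e = "\<lambda>m. exp (- k * x - t) * wright m (k * x * t)"
    have "f_S' \<alpha> x t = k * t * (k * t * ?e 2 - k * ?e 1)"
      by (simp add: f_S'_def k_def algebra_simps)
    then have "\<bar>f_S' \<alpha> x t\<bar> = k * t * \<bar>k * t * ?e 2 - k * ?e 1\<bar>"
      using k assms by (simp add: abs_mult)
    also have "\<dots> \<le> k * t * (k * t * ?e 2 + k * ?e 1)"
    proof -
      have "0 \<le> k * t * ?e 2" "0 \<le> k * ?e 1"
        by (rule mult_nonneg_nonneg[OF _ nn[OF x]], use k assms in simp)+
      then show ?thesis using k assms by (intro mult_left_mono) auto
    qed
    also have "\<dots> \<le> k * t * (k * t * (exp t * exp (- (k / 2) * x)) + k * (exp t * exp (- (k / 2) * x)))"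
      using k assms x by (intro mult_left_mono add_mono *) auto
    finally show ?thesis by (simp add: algebra_simps)
  qed
  then have 2: "(\<lambda>x. f_S' \<alpha> x t) absolutely_integrable_on {0..}"
    using k by (intro absolutely_integrable_exp_bound[where a = "k / 2"] continuous_on_f_S') auto
  have 3: "AC_loc_pos (\<lambda>x. f_S \<alpha> x t)"
    unfolding AC_loc_pos_def using abs_cont_on_C1[OF has_derivative_f_S continuous_on_f_S'] by blast
  have "(\<lambda>x. f_S \<alpha> x t) differentiable_on {0..}"
    using has_derivative_f_S
    by (meson differentiable_at_withinI differentiable_on_def real_differentiable_def)
  with 1 2 3 show ?thesis by (simp add: CF_domain_def deriv)
qed

lemma f_S_solution:
  assumes "0 < \<alpha>" "\<alpha> < 1"
  shows "CF_solution \<alpha> (f_S \<alpha>)"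
  unfolding CF_solution_def
proof (intro conjI allI impI)
  fix x t :: real assume xt: "0 \<le> x" "0 \<le> t"
  define k where "k = k_CF \<alpha>"
  \<comment> \<open>Multiplying \<open>f_S \<alpha> z t\<close> by the kernel makes the exponential
    free of \<open>z\<close>, leaving the exact derivative of
    \<open>wright 0 (k * z * t)\<close>.\<close>
  have "((\<lambda>z. exp (- k * x - t) * (k * t * wright 1 (k * z * t))) has_integral
     exp (- k * x - t) * wright 0 (k * x * t) - exp (- k * x - t) * wright 0 (k * 0 * t)) {0..x}"
    by (rule fundamental_theorem_of_calculus[OF xt(1)])
      (auto intro!: derivative_eq_intros simp: has_real_derivative_iff_has_vector_derivative[symmetric] mult_ac)
  moreover have "exp (- k * x - t) * (k * t * wright 1 (k * z * t)) = f_S \<alpha> z t * exp (- k * (x - z))" for z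
  proof -
    have "exp (- k * x - t) = exp (- k * z - t) * exp (- k * (x - z))"
      by (simp add: exp_add[symmetric] algebra_simps)
    then show ?thesis by (simp only: f_S_eq k_def[symmetric] mult_ac)
  qed
  ultimately have int: "integral {0..x} (\<lambda>z. f_S \<alpha> z t * exp (- k * (x - z))) =
      exp (- k * x - t) * (wright 0 (k * x * t) - 1)"
    by (simp add: integral_unique algebra_simps)
  have "((\<lambda>s. f_S \<alpha> x s) has_real_derivative
     k * exp (- k * x - t) * (wright 1 (k * x * t) + k * x * t * wright 2 (k * x * t)) - f_S \<alpha> x t) (at t)"
    unfolding f_S_eq k_def[symmetric]
    by (auto intro!: derivative_eq_intros simp: numeral_2_eq_2 algebra_simps)
  then have "((\<lambda>s. f_S \<alpha> x s) has_real_derivative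
     k * exp (- k * x - t) * wright 0 (k * x * t) - f_S \<alpha> x t) (at t within {0..})"
    unfolding wright_recurrence by (rule has_field_derivative_at_within)
  \<comment> \<open>The boundary term from \<open>f_S \<alpha> 0 t = k * t * exp (- t)\<close> and
    the \<open>- 1\<close> in \<open>int\<close> together cancel the source term.\<close>
  also have "k * exp (- k * x - t) * wright 0 (k * x * t) - f_S \<alpha> x t =
     - CF_deriv (\<lambda>a. 1 - a) \<alpha> (\<lambda>z. f_S \<alpha> z t) x + k_CF \<alpha> * (1 - t) * exp (- t - k_CF \<alpha> * x)"
    unfolding CF_deriv_eq[OF assms f_S_in_CF_domain[OF assms xt(2)] xt(1)] k_def[symmetric] int
    by (simp add: f_S_eq k_def[symmetric] exp_diff exp_minus field_simps)
  finally show "((\<lambda>s. f_S \<alpha> x s) has_real_derivative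
     - CF_deriv (\<lambda>a. 1 - a) \<alpha> (\<lambda>z. f_S \<alpha> z t) x + k_CF \<alpha> * (1 - t) * exp (- t - k_CF \<alpha> * x))
     (at t within {0..})" .
next
  show "(\<lambda>x. f_S \<alpha> x t) \<in> CF_domain" if "0 \<le> t" for t
    by (rule f_S_in_CF_domain[OF assms that])
  show "f_S \<alpha> x 0 = 0" for x
    by (simp add: f_S_def)
qed

text \<open>The source term cancels in the difference \<open>h\<close>. The operator at
  \<open>y\<close> sees only \<open>{0..y}\<close>, so each strip \<open>{0..x}\<close> can be
  treated by itself.\<close>

lemma CF_solution_unique:
  assumes \<alpha>: "0 < \<alpha>" "\<alpha> < 1" and f: "CF_solution \<alpha> f" and g: "CF_solution \<alpha> g"
    and "0 \<le> x" "0 \<le> t"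
  shows "f x t = g x t"
proof -
  define k where "k = k_CF \<alpha>"
  have k: "0 < k" using \<alpha> by (simp add: k_def k_CF_pos)
  define h where "h x t = f x t - g x t" for x t
  let ?D = "\<lambda>f t x. CF_deriv (\<lambda>a. 1 - a) \<alpha> (\<lambda>z. f z t) x"
  have cont: "continuous_on S (\<lambda>x. f x t)" if "CF_solution \<alpha> f" "0 \<le> t" "S \<subseteq> {0..}" for f t S
    using that by (auto simp: CF_solution_def CF_domain_def
        intro!: differentiable_imp_continuous_on[THEN continuous_on_subset])
  have D: "?D f t x - ?D g t x = h x t - h 0 t * exp (- k * x) - k * integral {0..x} (\<lambda>z. h z t * exp (- k * (x - z)))"
    if "0 \<le> x" "0 \<le> t" for x t
  proof -
    have dom: "(\<lambda>z. f z t) \<in> CF_domain" "(\<lambda>z. g z t) \<in> CF_domain"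
      using f g that by (auto simp: CF_solution_def)
    have int: "integral {0..x} (\<lambda>z. h z t * exp (- k * (x - z))) =
      integral {0..x} (\<lambda>z. f z t * exp (- k * (x - z))) - integral {0..x} (\<lambda>z. g z t * exp (- k * (x - z)))"
      unfolding h_def left_diff_distrib
      by (intro integral_diff integrable_continuous_interval continuous_intros cont f g that) auto
    show ?thesis
      unfolding CF_deriv_eq[OF \<alpha> dom(1) that(1)] CF_deriv_eq[OF \<alpha> dom(2) that(1)] k_def[symmetric] int
      by (simp add: h_def algebra_simps)
  qed
  \<comment> \<open>In the constant, \<open>h y t\<close> and the boundary term contribute 1 each,
    and the integral over an interval of length at most \<open>x\<close> contributes
    \<open>k * x\<close>.\<close>
  interpret derivative_bounded_by_sup "{0..x}" "2 + k * x" h "\<lambda>x t. - (?D f t x - ?D g t x)"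
  proof
    show "0 < 2 + k * x" using k \<open>0 \<le> x\<close> by (simp add: add_pos_nonneg)
  next
    fix y t :: real assume yt: "y \<in> {0..x}" "0 \<le> t"
    have "((\<lambda>s. f y s - g y s) has_real_derivative
       (- ?D f t y + k_CF \<alpha> * (1 - t) * exp (- t - k_CF \<alpha> * y)) -
       (- ?D g t y + k_CF \<alpha> * (1 - t) * exp (- t - k_CF \<alpha> * y))) (at t within {0..})"
      using f g yt by (intro DERIV_diff) (auto simp: CF_solution_def)
    then show "(h y has_real_derivative - (?D f t y - ?D g t y)) (at t within {0..})"
      by (simp add: h_def[abs_def])
  next
    fix m t y assume t: "0 \<le> t" and m: "\<And>z. z \<in> {0..x} \<Longrightarrow> \<bar>h z t\<bar> \<le> m" and y: "y \<in> {0..x}"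
    have "0 \<le> m" using m[OF y] by linarith
    have le1: "exp (- k * (y - z)) \<le> 1" if "z \<in> {0..y}" for z
      using that k by simp
    have "norm (integral {0..y} (\<lambda>z. h z t * exp (- k * (y - z)))) \<le> m * (y - 0)"
    proof (rule integral_bound)
      show "continuous_on {0..y} (\<lambda>z. h z t * exp (- k * (y - z)))"
        unfolding h_def by (intro continuous_intros cont f g t) auto
      show "norm (h z t * exp (- k * (y - z))) \<le> m" if z: "z \<in> {0..y}" for z
      proof -
        have "\<bar>h z t\<bar> * exp (- k * (y - z)) \<le> m * 1"
          using z y \<open>0 \<le> m\<close> by (intro mult_mono m le1) auto
        then show "norm (h z t * exp (- k * (y - z))) \<le> m" by (simp add: abs_mult)
      qed
    qed (use y in simp)
    then have "\<bar>integral {0..y} (\<lambda>z. h z t * exp (- k * (y - z)))\<bar> \<le> m * y" using y by simp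
    also have "\<dots> \<le> m * x" using y \<open>0 \<le> m\<close> by (intro mult_left_mono) auto
    finally have "\<bar>k * integral {0..y} (\<lambda>z. h z t * exp (- k * (y - z)))\<bar> \<le> k * (m * x)"
      using k by (simp add: abs_mult)
    moreover have "\<bar>h 0 t * exp (- k * y)\<bar> \<le> m * 1"
      unfolding abs_mult using y k \<open>0 \<le> m\<close> by (intro mult_mono m) auto
    moreover have "(2 + k * x) * m = m + m * 1 + k * (m * x)" by (simp add: algebra_simps)
    moreover have "?D f t y - ?D g t y = h y t - h 0 t * exp (- k * y) -
        k * integral {0..y} (\<lambda>z. h z t * exp (- k * (y - z)))"
      using D[of y t] y t by simp
    ultimately show "\<bar>- (?D f t y - ?D g t y)\<bar> \<le> (2 + k * x) * m"
      using m[OF y] by linarith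
  next
    fix t :: real assume "0 \<le> t"
    then have "bounded ((\<lambda>z. h z t) ` {0..x})"
      unfolding h_def
      by (intro compact_imp_bounded compact_continuous_image continuous_intros cont f g) auto
    then show "\<exists>m. \<forall>z\<in>{0..x}. \<bar>h z t\<bar> \<le> m"
      unfolding bounded_iff by auto
  qed
  have "h x t = 0"
  proof (rule eq_0_if_initially_0)
    show "h y 0 = 0" if "y \<in> {0..x}" for y
      using f g that by (simp add: h_def CF_solution_def)
  qed (use assms(5,6) in auto)
  then show ?thesis by (simp add: h_def)
qed

subsection \<open>The compound Poisson process\<close>

lemma poisson_process_prob:
  assumes N: "poisson_process M \<rho> N" and "0 < \<rho>" "0 \<le> t"
  shows "measure M {\<omega> \<in> space M. N t \<omega> = n} = (\<rho> * t) ^ n / fact n * exp (- (\<rho> * t))"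
proof -
  interpret prob_space M using N by (simp add: poisson_process_def)
  have meas [measurable]: "N s \<in> measurable M (count_space UNIV)" if "0 \<le> s" for s
    using N that by (simp add: poisson_process_def)
  have N0: "AE \<omega> in M. N 0 \<omega> = 0"
    using N by (auto simp: poisson_process_def)
  have [measurable]: "N 0 \<in> measurable M (count_space UNIV)" "N t \<in> measurable M (count_space UNIV)"
    using meas \<open>0 \<le> t\<close> by auto
  show ?thesis
  \<comment> \<open>The law of increments is prescribed only for \<open>s < t\<close>; at time 0 the
    almost sure value \<open>N 0 = 0\<close> takes its place.\<close>
  proof (cases "t = 0")
    case True
    have "prob {\<omega> \<in> space M. N 0 \<omega> = n} = prob {\<omega> \<in> space M. n = 0}"
      using N0 by (intro finite_measure_eq_AE) auto
    then show ?thesis using True by (cases n) (auto simp: prob_space)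
  next
    case False
    then have t: "0 < t" using \<open>0 \<le> t\<close> by simp
    have "emeasure M {\<omega> \<in> space M. N t \<omega> = n} = emeasure M {\<omega> \<in> space M. N t \<omega> - N 0 \<omega> = n}"
      using N0 by (intro emeasure_eq_AE) auto
    also have "\<dots> = emeasure (distr M (count_space UNIV) (\<lambda>\<omega>. N t \<omega> - N 0 \<omega>)) {n}"
      by (subst emeasure_distr) (auto intro!: arg_cong2[where f = emeasure])
    also have "\<dots> = emeasure (measure_pmf (poisson_pmf (\<rho> * (t - 0)))) {n}"
      using N t unfolding poisson_process_def by (metis order_refl)
    also have "\<dots> = ennreal ((\<rho> * t) ^ n / fact n * exp (- (\<rho> * t)))"
      using \<open>0 < \<rho>\<close> t by (simp add: emeasure_pmf_single)
    finally show ?thesis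
      using \<open>0 < \<rho>\<close> t by (simp add: emeasure_eq_measure)
  qed
qed

text \<open>Each event is the preimage of a measurable set of the product space, the first through
  the coordinate \<open>t\<close> and the second through the coordinates \<open>1..m\<close>, so
  they lie in the two independent sigma-algebras.\<close>

lemma indep_process_seq_prob:
  assumes "prob_space M" and ind: "indep_process_seq M N X" and "0 \<le> t"
  shows "measure M ({\<omega> \<in> space M. N t \<omega> = n} \<inter> {\<omega> \<in> space M. (\<Sum>j=1..m. X j \<omega>) \<le> y}) =
    measure M {\<omega> \<in> space M. N t \<omega> = n} * measure M {\<omega> \<in> space M. (\<Sum>j=1..m. X j \<omega>) \<le> y}"
proof -
  interpret prob_space M by fact
  let ?P = "\<Pi>\<^sub>M t\<in>{0::real..}. count_space (UNIV :: nat set)"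
  let ?Q = "\<Pi>\<^sub>M j\<in>{1::nat..}. (borel :: real measure)"
  show ?thesis
  proof (rule indep_setD[OF ind[unfolded indep_process_seq_def]])
    have [measurable]: "(\<lambda>g. g t) \<in> measurable ?P (count_space UNIV)"
      using \<open>0 \<le> t\<close> by (intro measurable_component_singleton) auto
    have "{g \<in> space ?P. g t = n} \<in> sets ?P" by measurable
    then have "(\<lambda>\<omega>. \<lambda>t\<in>{0..}. N t \<omega>) -` {g \<in> space ?P. g t = n} \<inter> space M
      \<in> sets (vimage_algebra (space M) (\<lambda>\<omega>. \<lambda>t\<in>{0..}. N t \<omega>) ?P)"
      by (rule in_vimage_algebra)
    also have "(\<lambda>\<omega>. \<lambda>t\<in>{0..}. N t \<omega>) -` {g \<in> space ?P. g t = n} \<inter> space M = {\<omega> \<in> space M. N t \<omega> = n}"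
      using \<open>0 \<le> t\<close> by (auto simp: space_PiM)
    finally show "{\<omega> \<in> space M. N t \<omega> = n} \<in> sets (vimage_algebra (space M) (\<lambda>\<omega>. \<lambda>t\<in>{0..}. N t \<omega>) ?P)" .
  next
    have [measurable]: "(\<lambda>g. \<Sum>j=1..m. g j) \<in> measurable ?Q borel"
      by (intro borel_measurable_sum measurable_component_singleton) auto
    have "{g \<in> space ?Q. (\<Sum>j=1..m. g j) \<le> y} \<in> sets ?Q" by measurable
    then have "(\<lambda>\<omega>. \<lambda>j\<in>{1..}. X j \<omega>) -` {g \<in> space ?Q. (\<Sum>j=1..m. g j) \<le> y} \<inter> space M
      \<in> sets (vimage_algebra (space M) (\<lambda>\<omega>. \<lambda>j\<in>{1..}. X j \<omega>) ?Q)"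
      by (rule in_vimage_algebra)
    also have "(\<lambda>\<omega>. \<lambda>j\<in>{1..}. X j \<omega>) -` {g \<in> space ?Q. (\<Sum>j=1..m. g j) \<le> y} \<inter> space M =
        {\<omega> \<in> space M. (\<Sum>j=1..m. X j \<omega>) \<le> y}"
    proof -
      have "(\<Sum>j=1..m. (\<lambda>j\<in>{1..}. X j \<omega>) j) = (\<Sum>j=1..m. X j \<omega>)" for \<omega>
        by (intro sum.cong) auto
      then show ?thesis by (auto simp: space_PiM)
    qed
    finally show "{\<omega> \<in> space M. (\<Sum>j=1..m. X j \<omega>) \<le> y} \<in> sets (vimage_algebra (space M) (\<lambda>\<omega>. \<lambda>j\<in>{1..}. X j \<omega>) ?Q)" .
  qed
qed

text \<open>The index \<open>m\<close> belongs to \<open>Suc m\<close> jumps, since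
  \<open>erlang_density m\<close> is the density of a sum of \<open>m + 1\<close> exponential
  variables. For negative \<open>x\<close> that density is 0, while \<open>f_S\<close> need not
  be.\<close>

lemma f_S_sums_erlang:
  assumes "0 \<le> x"
  shows "(\<lambda>m. (t ^ Suc m / fact (Suc m) * exp (- t)) * erlang_density m (k_CF \<alpha>) x) sums f_S \<alpha> x t"
proof -
  define k where "k = k_CF \<alpha>"
  have "(\<lambda>m. inverse (fact m * fact (m + 1)) * (k * x * t) ^ m) sums wright 1 (k * x * t)"
    unfolding wright_def by (rule summable_sums[OF summable_wright])
  then have "(\<lambda>m. k * t * exp (- k * x - t) * (inverse (fact m * fact (m + 1)) * (k * x * t) ^ m)) sums f_S \<alpha> x t"
    unfolding f_S_eq k_def[symmetric] by (rule sums_mult)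
  also have "(\<lambda>m. k * t * exp (- k * x - t) * (inverse (fact m * fact (m + 1)) * (k * x * t) ^ m)) =
    (\<lambda>m. (t ^ Suc m / fact (Suc m) * exp (- t)) * erlang_density m k x)"
    using assms by (simp add: erlang_density_def fun_eq_iff exp_diff exp_minus power_mult_distrib divide_simps)
  finally show ?thesis unfolding k_def .
qed

text \<open>Membership in \<open>CF_domain\<close> gives integrability for the completed measure;
  Borel measurability carries it over to \<open>lborel\<close>.\<close>

lemma integrable_f_S:
  assumes "0 < \<alpha>" "\<alpha> < 1" "0 \<le> t"
  shows "integrable lborel (\<lambda>x. if 0 \<le> x then f_S \<alpha> x t else 0)"
proof -
  have [measurable]: "(\<lambda>x. f_S \<alpha> x t) \<in> borel_measurable borel"
    by (rule borel_measurable_continuous_onI) (rule continuous_on_f_S)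
  have eq: "(\<lambda>x. indicator {0..} x *\<^sub>R f_S \<alpha> x t) = (\<lambda>x. if 0 \<le> x then f_S \<alpha> x t else 0)"
    by (auto simp: indicator_def)
  have "integrable lebesgue (\<lambda>x. indicator {0..} x *\<^sub>R f_S \<alpha> x t)"
    using f_S_in_CF_domain[OF assms] by (simp add: CF_domain_def set_integrable_def)
  then show ?thesis
    unfolding eq by (subst (asm) integrable_completion) auto
qed

lemma compound_poisson_ac_density:
  assumes \<alpha>: "0 < \<alpha>" "\<alpha> < 1"
    and N: "poisson_process M 1 N"
    and iX: "prob_space.indep_vars M (\<lambda>_. borel) X {1..}"
    and X: "\<And>j. 1 \<le> j \<Longrightarrow> distributed M lborel (X j) (exponential_density (k_CF \<alpha>))"
    and ind: "indep_process_seq M N X" and t: "0 \<le> t"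
  shows "ac_component_density M (compound_poisson N X) t (\<lambda>x. if 0 \<le> x then f_S \<alpha> x t else 0)"
proof -
  define k where "k = k_CF \<alpha>"
  have k: "0 < k" using \<alpha> by (simp add: k_def k_CF_pos)
  interpret prob_space M using N by (simp add: poisson_process_def)
  let ?S = "compound_poisson N X t" and ?F = "\<lambda>x. if 0 \<le> x then f_S \<alpha> x t else 0"
  define p where "p n = t ^ n / fact n * exp (- t)" for n
  have p: "0 \<le> p n" "prob {\<omega> \<in> space M. N t \<omega> = n} = p n" for n
    using t poisson_process_prob[OF N _ t, of n] by (simp_all add: p_def)
  have Nm [measurable]: "N t \<in> measurable M (count_space UNIV)"
    using N t by (simp add: poisson_process_def)
  have sum_meas [measurable]: "(\<lambda>\<omega>. \<Sum>j=1..n. X j \<omega>) \<in> borel_measurable M" for n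
    using distributed_measurable[OF X] by (intro borel_measurable_sum) auto
  have S_meas [measurable]: "?S \<in> borel_measurable M"
    unfolding compound_poisson_def[abs_def]
    by (rule measurable_compose_countable[OF sum_meas Nm])
  have F_nonneg: "0 \<le> ?F x" for x using f_S_nonneg[OF \<alpha> t] by simp
  note F_int = integrable_f_S[OF \<alpha> t]
  have erl: "emeasure M {\<omega> \<in> space M. (\<Sum>j=1..Suc m. X j \<omega>) \<le> y} =
      (\<integral>\<^sup>+x. ennreal (erlang_density m k x) * indicator {..y} x \<partial>lborel)" for m y
  proof -
    have "distributed M lborel (\<lambda>\<omega>. \<Sum>j\<in>{1..Suc m}. X j \<omega>) (erlang_density (card {1..Suc m} - 1) k)"
      using k X indep_vars_subset[OF iX]
      by (intro exponential_distributed_sum) (auto simp: k_def)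
    from distributed_emeasure[OF this, of "{..y}"] show ?thesis
      by (simp add: vimage_def Int_def conj_commute)
  qed
  have "prob {\<omega> \<in> space M. ?S \<omega> \<le> y} = exp (- t) * indicator {0..} y + (LBINT x:{..y}. ?F x)" for y
  proof -
    define A where "A n = {\<omega> \<in> space M. N t \<omega> = n} \<inter> {\<omega> \<in> space M. (\<Sum>j=1..n. X j \<omega>) \<le> y}" for n
    define q where "q n = emeasure M {\<omega> \<in> space M. (\<Sum>j=1..n. X j \<omega>) \<le> y}" for n
    have A: "A n \<in> sets M" for n unfolding A_def by measurable
    \<comment> \<open>In the extended nonnegative reals, sums and integrals can be exchanged without
      integrability checks; \<open>F_int\<close> enters only on the return to a real
      integral.\<close>
    have "emeasure M {\<omega> \<in> space M. ?S \<omega> \<le> y} = emeasure M (\<Union>n. A n)"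
      by (intro arg_cong2[where f = emeasure]) (auto simp: A_def compound_poisson_def)
    also have "\<dots> = (\<Sum>n. emeasure M (A n))"
      using A by (intro suminf_emeasure[symmetric]) (auto simp: A_def disjoint_family_on_def)
    also have "\<dots> = (\<Sum>n. ennreal (p n) * q n)"
      unfolding A_def q_def using indep_process_seq_prob[OF prob_space_axioms ind t] p
      by (simp add: emeasure_eq_measure ennreal_mult)
    also have "\<dots> = (\<Sum>m. ennreal (p (Suc m)) * q (Suc m)) + ennreal (p 0) * q 0"
      by (intro sums_unique[symmetric] sums_Suc summable_sums) auto
    \<comment> \<open>Without jumps the sum is empty, hence 0, and \<open>0 \<le> y\<close> holds
      surely or never: this is the atom at the origin.\<close>
    also have "ennreal (p 0) * q 0 = ennreal (exp (- t) * indicator {0..} y)"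
      by (auto simp: p_def q_def indicator_def emeasure_space_1)
    also have "(\<Sum>m. ennreal (p (Suc m)) * q (Suc m)) =
      (\<Sum>m. \<integral>\<^sup>+x. ennreal (p (Suc m)) * (ennreal (erlang_density m k x) * indicator {..y} x) \<partial>lborel)"
      unfolding q_def erl by (intro suminf_cong nn_integral_cmult[symmetric]) measurable
    also have "\<dots> = (\<integral>\<^sup>+x. (\<Sum>m. ennreal (p (Suc m)) * (ennreal (erlang_density m k x) * indicator {..y} x)) \<partial>lborel)"
      by (intro nn_integral_suminf[symmetric]) measurable
    also have "\<dots> = (\<integral>\<^sup>+x. ennreal (indicator {..y} x *\<^sub>R ?F x) \<partial>lborel)"
    proof (intro nn_integral_cong)
      fix x :: real
      have "(\<lambda>m. p (Suc m) * erlang_density m k x) sums ?F x"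
      proof (cases "0 \<le> x")
        case True
        then show ?thesis using f_S_sums_erlang[OF True, of t \<alpha>] by (simp add: p_def k_def)
      qed (simp add: erlang_density_def)
      then have "(\<Sum>m. ennreal (p (Suc m) * erlang_density m k x)) = ennreal (?F x)"
        using p k by (intro suminf_ennreal_eq) auto
      then show "(\<Sum>m. ennreal (p (Suc m)) * (ennreal (erlang_density m k x) * indicator {..y} x)) =
          ennreal (indicator {..y} x *\<^sub>R ?F x)"
        using p k by (cases "x \<le> y") (auto simp: ennreal_mult)
    qed
    also have "\<dots> = ennreal (LBINT x:{..y}. ?F x)"
      unfolding set_lebesgue_integral_def using F_nonneg
      by (intro nn_integral_eq_integral integrable_mult_indicator[OF _ F_int]) auto
    finally have "ennreal (prob {\<omega> \<in> space M. ?S \<omega> \<le> y}) =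
        ennreal (LBINT x:{..y}. ?F x) + ennreal (exp (- t) * indicator {0..} y)"
      by (simp add: emeasure_eq_measure)
    moreover have "0 \<le> (LBINT x:{..y}. ?F x)"
      unfolding set_lebesgue_integral_def using F_nonneg by (intro Bochner_Integration.integral_nonneg) auto
    ultimately show ?thesis
      by (simp add: ennreal_plus[symmetric] ennreal_inj add.commute del: ennreal_plus)
  qed
  with S_meas F_int F_nonneg show ?thesis
    unfolding ac_component_density_def by auto
qed

theorem theorem1:
  fixes \<alpha> :: real
  assumes "0 < \<alpha>" and "\<alpha> < 1"
  shows "CF_solution \<alpha> (f_S \<alpha>) \<and>
    (\<forall>g. CF_solution \<alpha> g \<longrightarrow> (\<forall>x\<ge>0. \<forall>t\<ge>0. g x t = f_S \<alpha> x t)) \<and>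
    (\<forall>(M :: 'a measure) N X.
       poisson_process M 1 N \<and>
       prob_space.indep_vars M (\<lambda>_. borel) X {1..} \<and>
       (\<forall>j\<ge>1. distributed M lborel (X j) (exponential_density (k_CF \<alpha>))) \<and>
       indep_process_seq M N X \<longrightarrow>
       (\<forall>t\<ge>0. ac_component_density M (compound_poisson N X) t
                 (\<lambda>x. if 0 \<le> x then f_S \<alpha> x t else 0)))"
  using f_S_solution[OF assms] CF_solution_unique[OF assms]
    compound_poisson_ac_density[OF assms]
  by blast

end
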